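(* Let $\mathcal{M}$ be an aperiodic, irreducible Markov chain on a countable state space $\Omega$ with stationary distribution $\pi$, let $C$ be a coupling on two copies of $\mathcal{M}$, let $p\in[0,1]$, let $t$ be a positive integer, and let $f$ be a function on $\Omega$. Let $X_t$ and $Y_t$ denote the states of the two copies after $t$ steps according to $C$. Suppose that for all initial states $x_0,y_0\in\Omega$, when the two copies are started at $X_0=x_0$, $Y_0=y_0$ and evolve according to $C$, one has $\Pr(f(X_t)=f(Y_t))\ge p$. Then for every initial state $x_0\in\Omega$, the distribution of $f(X_t)$ (with $X_0=x_0$) is within $1-p$, in total variation distance, of the stationary distribution $f(\pi)$ of $f$.
   Context: A coupling $C$ on two copies of a Markov chain $\mathcal{M}$ is a rule that, for every pair of initial states $(x_0,y_0)$, specifies a joint random process $(X_s,Y_s)_{s\ge 0}$ with $X_0=x_0$, $Y_0=y_0$ such that each of $(X_s)$ and $(Y_s)$, considered on its own, is a Markov chain evolving according to the transition probabilities of $\mathcal{M}$. The stationary distribution of $f$, denoted $f(\pi)$, is the distribution of $f(Z)$ where $Z$ has the stationary distribution $\pi$ of $\mathcal{M}$. *)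

theory Defs
  imports "HOL-Probability.Probability"
begin

text \<open>A chain on a countable type is given by its transition kernel \<open>K\<close>:
  \<open>pmf (K x) y\<close> is the probability of moving from \<open>x\<close> to \<open>y\<close> in one step.\<close>

primrec step_pmf :: "('a \<Rightarrow> 'a pmf) \<Rightarrow> nat \<Rightarrow> 'a \<Rightarrow> 'a pmf" where
  "step_pmf K 0 x = return_pmf x"
| "step_pmf K (Suc n) x = bind_pmf (step_pmf K n x) K"

definition irreducible_kernel :: "('a \<Rightarrow> 'a pmf) \<Rightarrow> bool" where
  "irreducible_kernel K \<longleftrightarrow> (\<forall>x y. \<exists>n. pmf (step_pmf K n x) y > 0)"

definition aperiodic_kernel :: "('a \<Rightarrow> 'a pmf) \<Rightarrow> bool" where
  "aperiodic_kernel K \<longleftrightarrow> (\<forall>x. Gcd {n. n > 0 \<and> pmf (step_pmf K n x) x > 0} = 1)"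

definition stationary_pmf :: "('a \<Rightarrow> 'a pmf) \<Rightarrow> 'a pmf \<Rightarrow> bool" where
  "stationary_pmf K \<pi> \<longleftrightarrow> bind_pmf \<pi> K = \<pi>"

text \<open>The initial condition is only required almost surely. The Markov property is with respect to
  the history of \<open>X\<close> itself, and is required only for histories of positive probability.\<close>

definition markov_process ::
    "('a::countable \<Rightarrow> 'a pmf) \<Rightarrow> 'a \<Rightarrow> 'w measure \<Rightarrow> (nat \<Rightarrow> 'w \<Rightarrow> 'a) \<Rightarrow> bool" where
  "markov_process K x0 M X \<longleftrightarrow>
     prob_space M \<and>
     (\<forall>s. X s \<in> measurable M (count_space UNIV)) \<and>
     (AE \<omega> in M. X 0 \<omega> = x0) \<and>
     (\<forall>n h y. \<P>(\<omega> in M. \<forall>i\<le>n. X i \<omega> = h i) > 0 \<longrightarrow>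
        \<P>(\<omega> in M. X (Suc n) \<omega> = y \<bar> \<forall>i\<le>n. X i \<omega> = h i) = pmf (K (h n)) y)"

text \<open>For initial states \<open>x0\<close>, \<open>y0\<close> the two copies are the processes \<open>X x0 y0\<close> and \<open>Y x0 y0\<close>,
  living on the common probability space \<open>P x0 y0\<close>. Nothing is assumed about their joint law;
  in particular the pair need not be a Markov chain.\<close>

definition markov_coupling ::
    "('a::countable \<Rightarrow> 'a pmf) \<Rightarrow> ('a \<Rightarrow> 'a \<Rightarrow> 'w measure) \<Rightarrow>
     ('a \<Rightarrow> 'a \<Rightarrow> nat \<Rightarrow> 'w \<Rightarrow> 'a) \<Rightarrow> ('a \<Rightarrow> 'a \<Rightarrow> nat \<Rightarrow> 'w \<Rightarrow> 'a) \<Rightarrow> bool" where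
  "markov_coupling K P X Y \<longleftrightarrow>
     (\<forall>x0 y0. markov_process K x0 (P x0 y0) (X x0 y0) \<and>
              markov_process K y0 (P x0 y0) (Y x0 y0))"

text \<open>Meaningful for probability measures on the same \<open>\<sigma>\<close>-algebra.\<close>

definition total_variation :: "'b measure \<Rightarrow> 'b measure \<Rightarrow> real" where
  "total_variation M N = (SUP A\<in>sets M. \<bar>measure M A - measure N A\<bar>)"

end

theory Submission
  imports Defs
begin

text \<open>The state \<open>X t\<close> of a copy started at \<open>x\<close> has law \<open>step_pmf K t x\<close>, whatever the coupling
  (\<open>distr_markov_process\<close>). The coupling inequality (\<open>coupling_inequality\<close>) compares the copies
  started at \<open>x\<close> and at \<open>y\<close>: on every event \<open>f -` A\<close> their \<open>t\<close>-step laws differ by at most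
  \<open>1 - p\<close>, for every \<open>y\<close>. Now choose \<open>y\<close> at random from \<open>\<pi>\<close>. The \<open>t\<close>-step law averaged over \<open>y\<close>
  is again \<open>\<pi>\<close> (\<open>stationary_step\<close>), and averaging over \<open>y\<close> preserves a bound that is uniform in \<open>y\<close>.
  Hence the \<open>t\<close>-step law from \<open>x\<close> differs from \<open>\<pi>\<close> on \<open>f -` A\<close> by at most \<open>1 - p\<close>.
  The averaging happens at the level of laws: the copies started at different \<open>y\<close> may live on
  unrelated probability spaces, and the second copy is never started from \<open>\<pi>\<close> itself.\<close>

lemma nn_integral_countable_valued:
  fixes H :: "'w \<Rightarrow> 'b::countable"
  assumes H: "H \<in> measurable M (count_space UNIV)"
  shows "(\<integral>\<^sup>+\<omega>. g (H \<omega>) \<partial>M)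
    = (\<integral>\<^sup>+l. emeasure M {\<omega>\<in>space M. H \<omega> = l} * g l \<partial>count_space UNIV)"
proof -
  let ?e = "\<lambda>l. emeasure M {\<omega>\<in>space M. H \<omega> = l}"
  have "distr M (count_space UNIV) H = density (count_space UNIV) ?e"
  proof (rule measure_eqI_countable[where A = UNIV])
    fix l :: 'b
    have "H -` {l} \<inter> space M = {\<omega>\<in>space M. H \<omega> = l}" by auto
    then show "emeasure (distr M (count_space UNIV) H) {l}
        = emeasure (density (count_space UNIV) ?e) {l}"
      using H by (simp add: emeasure_distr emeasure_density)
  qed auto
  then have "(\<integral>\<^sup>+l. g l \<partial>distr M (count_space UNIV) H)
      = (\<integral>\<^sup>+l. g l \<partial>density (count_space UNIV) ?e)" by simp
  then show ?thesis using H by (simp add: nn_integral_distr nn_integral_density)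
qed

text \<open>The Markov property conditions on the whole history, so the one-step transition is obtained
  by summing over all histories. As a list of states, a history takes countably many values;
  those of probability zero contribute nothing.\<close>

lemma markov_process_step:
  assumes mp: "markov_process K x0 M X"
  shows "emeasure M {\<omega>\<in>space M. X (Suc n) \<omega> = y}
    = (\<integral>\<^sup>+\<omega>. ennreal (pmf (K (X n \<omega>)) y) \<partial>M)"
proof -
  interpret prob_space M using mp by (simp add: markov_process_def)
  have [measurable]: "X s \<in> measurable M (count_space UNIV)" for s
    using mp by (simp add: markov_process_def)
  define H where "H \<omega> = map (\<lambda>i. X i \<omega>) [0..<Suc n]" for \<omega>
  have H_eq: "H \<omega> = l \<longleftrightarrow> length l = Suc n \<and> (\<forall>i\<le>n. X i \<omega> = l ! i)" for \<omega> l
    unfolding H_def by (auto simp: list_eq_iff_nth_eq less_Suc_eq_le simp del: upt_Suc)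
  have H_pred: "Measurable.pred M (\<lambda>\<omega>. H \<omega> = l)" for l
    unfolding H_eq by measurable
  have H: "H \<in> measurable M (count_space UNIV)"
    using H_pred by (subst measurable_count_space_eq2_countable)
      (auto simp: pred_def vimage_def Int_def conj_commute)
  let ?E = "\<lambda>l. {\<omega>\<in>space M. H \<omega> = l}"
  let ?F = "\<lambda>l. {\<omega>\<in>space M. X (Suc n) \<omega> = y \<and> H \<omega> = l}"
  have E_sets: "?E l \<in> sets M" for l using H_pred by (simp add: pred_def)
  have F_sets: "?F l \<in> sets M" for l
  proof -
    have "?F l = {\<omega>\<in>space M. X (Suc n) \<omega> = y} \<inter> ?E l" by auto
    then show ?thesis using E_sets by simp
  qed
  have hist: "emeasure M (?F l) = emeasure M (?E l) * ennreal (pmf (K (l ! n)) y)" for l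
  proof (cases "prob (?E l) = 0")
    case True
    have "prob (?F l) \<le> prob (?E l)"
      using E_sets by (intro finite_measure_mono) auto
    then have "prob (?F l) = 0" using True by (simp add: measure_le_0_iff)
    then show ?thesis using True by (simp add: emeasure_eq_measure)
  next
    case False
    have len: "length l = Suc n"
    proof (rule ccontr)
      assume "length l \<noteq> Suc n"
      then have "?E l = {}" by (auto simp: H_eq)
      then have "prob (?E l) = 0" by (simp only: measure_empty)
      then show False using False by simp
    qed
    have pos: "\<P>(\<omega> in M. \<forall>i\<le>n. X i \<omega> = l ! i) > 0"
      using False len by (simp add: H_eq zero_less_measure_iff)
    have "\<P>(\<omega> in M. X (Suc n) \<omega> = y \<bar> \<forall>i\<le>n. X i \<omega> = l ! i) = pmf (K (l ! n)) y"
      using mp pos unfolding markov_process_def by blast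
    then have "prob (?F l) = prob (?E l) * pmf (K (l ! n)) y"
      using pos len by (simp add: cond_prob_def H_eq field_simps)
    then show ?thesis by (simp add: emeasure_eq_measure ennreal_mult)
  qed
  have "emeasure M {\<omega>\<in>space M. X (Suc n) \<omega> = y} = emeasure M (\<Union>l. ?F l)"
    by (rule arg_cong[where f = "emeasure M"]) auto
  also have "\<dots> = (\<integral>\<^sup>+l. emeasure M (?F l) \<partial>count_space UNIV)"
    using F_sets by (intro emeasure_UN_countable) (auto simp: disjoint_family_on_def)
  also have "\<dots> = (\<integral>\<^sup>+\<omega>. ennreal (pmf (K (H \<omega> ! n)) y) \<partial>M)"
    using nn_integral_countable_valued[OF H, of "\<lambda>l. ennreal (pmf (K (l ! n)) y)"]
    by (simp add: hist)
  also have "\<dots> = (\<integral>\<^sup>+\<omega>. ennreal (pmf (K (X n \<omega>)) y) \<partial>M)"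
    by (simp add: H_def nth_append del: upt_Suc)
  finally show ?thesis .
qed

lemma distr_markov_process:
  assumes mp: "markov_process K x0 M X"
  shows "distr M (count_space UNIV) (X n) = measure_pmf (step_pmf K n x0)"
proof (induction n)
  case 0
  interpret prob_space M using mp by (simp add: markov_process_def)
  have [measurable]: "X 0 \<in> measurable M (count_space UNIV)"
    using mp by (simp add: markov_process_def)
  have "distr M (count_space UNIV) (X 0) = distr M (count_space UNIV) (\<lambda>_. x0)"
    using mp by (intro distr_cong_AE) (auto simp: markov_process_def)
  then show ?case by (simp add: distr_const return_pmf.rep_eq)
next
  case (Suc n)
  have [measurable]: "X s \<in> measurable M (count_space UNIV)" for s
    using mp by (simp add: markov_process_def)
  show ?case
  proof (rule measure_eqI_countable[where A = UNIV])
    fix y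
    have "emeasure (distr M (count_space UNIV) (X (Suc n))) {y}
        = emeasure M {\<omega>\<in>space M. X (Suc n) \<omega> = y}"
      by (subst emeasure_distr) (auto intro!: arg_cong[where f = "emeasure M"])
    also have "\<dots> = (\<integral>\<^sup>+x. ennreal (pmf (K x) y) \<partial>distr M (count_space UNIV) (X n))"
      by (simp add: markov_process_step[OF mp] nn_integral_distr)
    also have "\<dots> = emeasure (step_pmf K (Suc n) x0) {y}"
      by (simp add: Suc.IH emeasure_pmf_single ennreal_pmf_bind)
    finally show "emeasure (distr M (count_space UNIV) (X (Suc n))) {y}
        = emeasure (step_pmf K (Suc n) x0) {y}" .
  qed auto
qed

corollary prob_markov_process:
  assumes "markov_process K x0 M X"
  shows "\<P>(\<omega> in M. X n \<omega> \<in> B) = measure (step_pmf K n x0) B"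
proof -
  have "X n \<in> measurable M (count_space UNIV)"
    using assms by (simp add: markov_process_def)
  then have "measure (distr M (count_space UNIV) (X n)) B = \<P>(\<omega> in M. X n \<omega> \<in> B)"
    by (subst measure_distr) (auto intro!: arg_cong[where f = "measure M"])
  then show ?thesis by (simp add: distr_markov_process[OF assms])
qed

text \<open>Whether \<open>f U\<close> lies in \<open>A\<close> and whether \<open>f V\<close> does can differ only where
  \<open>f U \<noteq> f V\<close>. Countability of the common range of \<open>U\<close> and \<open>V\<close> makes that event measurable for
  arbitrary \<open>f\<close>.\<close>

lemma (in prob_space) coupling_inequality:
  fixes U V :: "'a \<Rightarrow> 'b::countable"
  assumes [measurable]: "U \<in> measurable M (count_space UNIV)" "V \<in> measurable M (count_space UNIV)"
  shows "\<bar>\<P>(\<omega> in M. f (U \<omega>) \<in> A) - \<P>(\<omega> in M. f (V \<omega>) \<in> A)\<bar>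
    \<le> 1 - \<P>(\<omega> in M. f (U \<omega>) = f (V \<omega>))"
proof -
  let ?S = "{\<omega>\<in>space M. f (U \<omega>) = f (V \<omega>)}"
  have "Measurable.pred M (\<lambda>\<omega>. (\<lambda>u \<omega>. f u = f (V \<omega>)) (U \<omega>) \<omega>)"
    by (rule measurable_compose_countable) measurable
  then have S: "?S \<in> events" by (simp add: pred_def)
  have le: "\<P>(\<omega> in M. f (U' \<omega>) \<in> A) \<le> \<P>(\<omega> in M. f (V' \<omega>) \<in> A) + prob (space M - ?S)"
    if [measurable]: "V' \<in> measurable M (count_space UNIV)"
      and "\<And>\<omega>. \<omega> \<in> ?S \<Longrightarrow> f (U' \<omega>) = f (V' \<omega>)"
    for U' V' :: "'a \<Rightarrow> 'b"
  proof -
    have V': "{\<omega>\<in>space M. f (V' \<omega>) \<in> A} \<in> events" by measurable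
    have "\<P>(\<omega> in M. f (U' \<omega>) \<in> A) \<le> prob ({\<omega>\<in>space M. f (V' \<omega>) \<in> A} \<union> (space M - ?S))"
      using that(2) V' S by (intro finite_measure_mono sets.Un sets.compl_sets) force+
    also have "\<dots> \<le> \<P>(\<omega> in M. f (V' \<omega>) \<in> A) + prob (space M - ?S)"
      using V' S by (intro measure_Un_le sets.compl_sets)
    finally show ?thesis .
  qed
  show ?thesis
    using le[of V U] le[of U V] prob_compl[OF S] by auto
qed

lemma stationary_step:
  assumes "stationary_pmf K \<pi>"
  shows "bind_pmf \<pi> (step_pmf K n) = \<pi>"
proof (induction n)
  case 0
  have "step_pmf K 0 = return_pmf" by (rule ext) simp
  then show ?case by (simp add: bind_return_pmf')
next
  case (Suc n)
  have "bind_pmf \<pi> (step_pmf K (Suc n)) = bind_pmf (bind_pmf \<pi> (step_pmf K n)) K"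
    by (simp add: bind_assoc_pmf cong: bind_pmf_cong)
  also have "\<dots> = \<pi>" using assms Suc by (simp add: stationary_pmf_def)
  finally show ?case .
qed

lemma measure_bind_pmf_integral:
  "measure (bind_pmf q L) B = (\<integral>y. measure (L y) B \<partial>measure_pmf q)"
proof -
  have "ennreal (measure (bind_pmf q L) B) = (\<integral>\<^sup>+y. ennreal (measure (L y) B) \<partial>measure_pmf q)"
    by (simp add: measure_pmf.emeasure_eq_measure[symmetric] emeasure_bind_pmf)
  also have "\<dots> = ennreal (\<integral>y. measure (L y) B \<partial>measure_pmf q)"
    by (intro nn_integral_eq_integral measure_pmf.integrable_const_bound[where B = 1]) auto
  finally show ?thesis by (simp add: integral_nonneg_AE)
qed

lemma abs_diff_measure_bind_pmf_le:
  assumes "\<And>y. \<bar>c - measure (measure_pmf (L y)) B\<bar> \<le> d"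
  shows "\<bar>c - measure (bind_pmf q L) B\<bar> \<le> d"
proof -
  have int: "integrable (measure_pmf q) (\<lambda>y. measure (L y) B)"
    by (intro measure_pmf.integrable_const_bound[where B = 1]) auto
  have "c - d \<le> measure (L y) B" "measure (L y) B \<le> c + d" for y
    using assms[of y] by auto
  then have "c - d \<le> (\<integral>y. measure (L y) B \<partial>measure_pmf q)"
    and "(\<integral>y. measure (L y) B \<partial>measure_pmf q) \<le> c + d"
    using int by (auto intro!: measure_pmf.integral_ge_const measure_pmf.integral_le_const)
  then show ?thesis unfolding measure_bind_pmf_integral by auto
qed

theorem proposition9:
  fixes K :: "'a::countable \<Rightarrow> 'a pmf"
    and \<pi> :: "'a pmf"
    and P :: "'a \<Rightarrow> 'a \<Rightarrow> 'w measure"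
    and X Y :: "'a \<Rightarrow> 'a \<Rightarrow> nat \<Rightarrow> 'w \<Rightarrow> 'a"
    and f :: "'a \<Rightarrow> 'b"
    and p :: real
    and t :: nat
  assumes "irreducible_kernel K"
    and "aperiodic_kernel K"
    and "stationary_pmf K \<pi>"
    and "markov_coupling K P X Y"
    and "0 \<le> p" and "p \<le> 1"
    and "t > 0"
    and "\<And>x0 y0. \<P>(\<omega> in P x0 y0. f (X x0 y0 t \<omega>) = f (Y x0 y0 t \<omega>)) \<ge> p"
  shows "\<forall>x0 y0. total_variation
      (distr (P x0 y0) (count_space UNIV) (\<lambda>\<omega>. f (X x0 y0 t \<omega>)))
      (measure_pmf (map_pmf f \<pi>)) \<le> 1 - p"
proof (intro allI)
  fix x0 y0
  have mX: "markov_process K x (P x y) (X x y)" and mY: "markov_process K y (P x y) (Y x y)" for x y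
    using assms(4) by (auto simp: markov_coupling_def)
  have step: "\<bar>measure (step_pmf K t x0) (f -` A) - measure (step_pmf K t y) (f -` A)\<bar> \<le> 1 - p"
    for A y
  proof -
    interpret prob_space "P x0 y" using mX by (simp add: markov_process_def)
    have "X x0 y t \<in> measurable (P x0 y) (count_space UNIV)"
      "Y x0 y t \<in> measurable (P x0 y) (count_space UNIV)"
      using mX mY by (simp_all add: markov_process_def)
    from coupling_inequality[OF this, of f A] show ?thesis
      using assms(8)[where ?x0.0 = x0 and ?y0.0 = y] prob_markov_process[OF mX, of x0 y t "f -` A"]
        prob_markov_process[OF mY, of x0 y t "f -` A"]
      by simp
  qed
  have "\<bar>measure (step_pmf K t x0) (f -` A) - measure \<pi> (f -` A)\<bar> \<le> 1 - p" for A
    using abs_diff_measure_bind_pmf_le[where L = "step_pmf K t" and q = \<pi>, OF step]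
    by (simp add: stationary_step[OF assms(3)])
  moreover have "measure (distr (P x0 y0) (count_space UNIV) (\<lambda>\<omega>. f (X x0 y0 t \<omega>))) A
      = measure (step_pmf K t x0) (f -` A)" for A
  proof -
    have [measurable]: "X x0 y0 t \<in> measurable (P x0 y0) (count_space UNIV)"
      using mX by (simp add: markov_process_def)
    have "measure (distr (P x0 y0) (count_space UNIV) (\<lambda>\<omega>. f (X x0 y0 t \<omega>))) A
        = \<P>(\<omega> in P x0 y0. X x0 y0 t \<omega> \<in> f -` A)"
      by (subst measure_distr) (auto intro!: arg_cong[where f = "measure (P x0 y0)"])
    then show ?thesis using prob_markov_process[OF mX, of x0 y0 t "f -` A"] by simp
  qed
  ultimately show "total_variation (distr (P x0 y0) (count_space UNIV) (\<lambda>\<omega>. f (X x0 y0 t \<omega>)))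
      (measure_pmf (map_pmf f \<pi>)) \<le> 1 - p"
    unfolding total_variation_def by (intro cSUP_least) auto
qed

end
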